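(* Let $f:\mathbb{R}^n\to\mathbb{R}$ be a coercive function of class $C^1$ whose gradient is Lipschitz continuous with constant $L>0$, and let $x_0\in\mathbb{R}^n$. Let $t\mapsto E_K(t)=\frac12|\dot x(t)|^2$ be the kinetic energy function of the solution $x(\cdot)$ of the Cauchy problem $\ddot x+\nabla f(x)=0$, $x(0)=x_0$, $\dot x(0)=0$. Then there exists $\hat t\in(0,+\infty)$ such that $$\hat t\,\dot E_K(\hat t)-E_K(\hat t)<0.$$
   Context: $|\cdot|$ is the Euclidean norm on $\mathbb{R}^n$. Coercive means $f(x)\to+\infty$ as $|x|\to+\infty$. The function $f$ is not assumed to be convex.
   Formalization: The formal statement adds the hypothesis that the gradient of f at x_0 is nonzero; if it vanishes, the solution is constant, E_K is identically 0, and the strict inequality fails for every t. *)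

theory Defs
  imports "HOL-Analysis.Analysis"
begin

definition coercive :: "('a::real_normed_vector \<Rightarrow> real) \<Rightarrow> bool" where
  "coercive f \<longleftrightarrow> filterlim f at_top at_infinity"

text \<open>Trajectories are only constrained on \<open>[0, \<infinity>)\<close>: derivatives are taken within this
  half-line, hence they are one-sided at \<open>0\<close> and two-sided at positive times.\<close>

definition velocity :: "(real \<Rightarrow> 'a::real_normed_vector) \<Rightarrow> real \<Rightarrow> 'a" where
  "velocity x t = vector_derivative x (at t within {0..})"

definition kinetic_energy :: "(real \<Rightarrow> 'a::real_normed_vector) \<Rightarrow> real \<Rightarrow> real" where
  "kinetic_energy x t = 1 / 2 * (norm (velocity x t))\<^sup>2"

text \<open>\<open>x\<close> solves \<open>x'' + g(x) = 0\<close> on \<open>[0, \<infinity>)\<close> with \<open>x(0) = x0\<close>, \<open>x'(0) = 0\<close>.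
  The first differentiability clause makes \<^const>\<open>velocity\<close> the actual derivative.\<close>

definition solves_from_rest ::
  "('a::real_normed_vector \<Rightarrow> 'a) \<Rightarrow> 'a \<Rightarrow> (real \<Rightarrow> 'a) \<Rightarrow> bool" where
  "solves_from_rest g x0 x \<longleftrightarrow>
     (\<forall>t\<ge>0. x differentiable (at t within {0..})) \<and>
     (\<forall>t\<ge>0. velocity x differentiable (at t within {0..})) \<and>
     (\<forall>t\<ge>0. vector_derivative (velocity x) (at t within {0..}) + g (x t) = 0) \<and>
     x 0 = x0 \<and> velocity x 0 = 0"

end

theory Submission
  imports Defs
begin

text \<open>Energy is conserved and the coercive potential is bounded below, so the kinetic energy
  \<open>E\<close> is bounded. If \<open>t E'(t) \<ge> E(t)\<close> held for all \<open>t > 0\<close>, then \<open>E(t) / t\<close> would be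
  nondecreasing; since the motion does start, \<open>E\<close> would grow at least linearly.\<close>

text \<open>Coercivity makes \<open>f\<close> nonnegative outside some ball, and on the closed ball
  continuity and compactness bound it by some \<open>B\<close>; so \<open>min 0 (- B)\<close> serves
  on both regions.\<close>

lemma coercive_bounded_below:
  fixes f :: "'a::euclidean_space \<Rightarrow> real"
  assumes "coercive f" and cont: "continuous_on UNIV f"
  obtains m where "\<And>y. m \<le> f y"
proof -
  have "\<forall>\<^sub>F y in at_infinity. 0 \<le> f y"
    using assms(1) unfolding coercive_def filterlim_at_top by blast
  then obtain b where b: "\<And>y. b \<le> norm y \<Longrightarrow> 0 \<le> f y"
    unfolding eventually_at_infinity by blast
  have "bounded (f ` cball 0 b)"
    by (intro compact_imp_bounded compact_continuous_image continuous_on_subset[OF cont]) auto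
  then obtain B where B: "\<And>y. y \<in> cball 0 b \<Longrightarrow> norm (f y) \<le> B"
    unfolding bounded_iff by (meson imageI)
  have "min 0 (- B) \<le> f y" for y
  proof (cases "b \<le> norm y")
    case True
    then show ?thesis using b[of y] by simp
  next
    case False
    then show ?thesis using B[of y] by simp
  qed
  then show ?thesis by (rule that)
qed

lemma has_vector_derivative_velocity:
  assumes "solves_from_rest g x0 x" "t \<ge> 0"
  shows "(x has_vector_derivative velocity x t) (at t within {0..})"
  using assms unfolding solves_from_rest_def velocity_def vector_derivative_works by blast

lemma velocity_has_vector_derivative:
  assumes "solves_from_rest g x0 x" "t \<ge> 0"
  shows "(velocity x has_vector_derivative - g (x t)) (at t within {0..})"
proof -
  have "vector_derivative (velocity x) (at t within {0..}) = - g (x t)"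
    using assms unfolding solves_from_rest_def by (simp add: eq_neg_iff_add_eq_0)
  moreover have "velocity x differentiable (at t within {0..})"
    using assms unfolding solves_from_rest_def by simp
  ultimately show ?thesis by (simp add: vector_derivative_works)
qed

lemma kinetic_energy_has_derivative:
  fixes x :: "real \<Rightarrow> 'a::real_inner"
  assumes "solves_from_rest g x0 x" "t \<ge> 0"
  shows "(kinetic_energy x has_real_derivative - (g (x t) \<bullet> velocity x t)) (at t within {0..})"
proof -
  \<comment> \<open>The inner product form can be differentiated even where the velocity vanishes,
    as at time 0, where the norm itself is not differentiable.\<close>
  have "kinetic_energy x = (\<lambda>s. 1 / 2 * (velocity x s \<bullet> velocity x s))"
    by (rule ext) (simp add: kinetic_energy_def power2_norm_eq_inner)
  then show ?thesis
    using velocity_has_vector_derivative[OF assms]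
    by (auto simp: has_vector_derivative_def has_field_derivative_def inner_commute
        intro!: derivative_eq_intros)
qed

text \<open>The power \<open>- (g (x s) \<bullet> velocity x s)\<close> cancels the derivative of
  the potential along the trajectory, so the sum is constant on the convex set \<open>{0..}\<close>.
  Starting from rest makes the constant equal to \<open>f x0\<close>.\<close>

lemma energy_conservation:
  fixes x :: "real \<Rightarrow> 'a::real_inner"
  assumes grad: "\<And>y. GDERIV f y :> g y" and sol: "solves_from_rest g x0 x" and "t \<ge> 0"
  shows "kinetic_energy x t + f (x t) = f x0"
proof -
  let ?H = "\<lambda>s. kinetic_energy x s + f (x s)"
  have "(?H has_derivative (\<lambda>h. 0)) (at s within {0..})" if "s \<in> {0..}" for s
  proof -
    have s: "s \<ge> 0" using that by simp
    have "((\<lambda>s. f (x s)) has_derivative (\<lambda>h. (h *\<^sub>R velocity x s) \<bullet> g (x s))) (at s within {0..})"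
      by (rule has_derivative_compose[where g=f,
            OF has_vector_derivative_velocity[OF sol s, unfolded has_vector_derivative_def]
              grad[of "x s", unfolded gderiv_def]])
    from has_derivative_add[OF kinetic_energy_has_derivative[OF sol s,
          unfolded has_field_derivative_def] this]
    show ?thesis by (simp add: inner_commute algebra_simps)
  qed
  then obtain c where "\<And>s. s \<in> {0..} \<Longrightarrow> ?H s = c"
    using has_derivative_zero_constant[of "{0..}" ?H] by auto
  then have "?H t = ?H 0" using \<open>t \<ge> 0\<close> by simp
  then show ?thesis
    using sol by (simp add: solves_from_rest_def kinetic_energy_def)
qed

text \<open>The motion cannot stay at rest: a velocity vanishing on all of \<open>{0..}\<close>
  would have one-sided derivative 0 at time 0, whereas the equation prescribes \<open>- g x0\<close>
  there.\<close>

lemma obtain_positive_kinetic_energy: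
  assumes sol: "solves_from_rest g x0 x" and "g x0 \<noteq> 0"
  obtains s where "s > 0" "kinetic_energy x s > 0"
proof (rule ccontr)
  assume "\<not> thesis"
  with that have "kinetic_energy x s \<le> 0" if "s > 0" for s
    using \<open>s > 0\<close> not_le by blast
  then have v0: "velocity x s = 0" if "s \<ge> 0" for s
    using that sol by (cases "s = 0") (auto simp: kinetic_energy_def solves_from_rest_def)
  have "(velocity x has_vector_derivative 0) (at 0 within {0..})"
    by (rule has_vector_derivative_transform[where f="\<lambda>_. 0"]) (auto simp: v0)
  moreover have "(velocity x has_vector_derivative - g x0) (at 0 within {0..})"
    using velocity_has_vector_derivative[OF sol, of 0] sol by (simp add: solves_from_rest_def)
  \<comment> \<open>Derivatives within a set are unique only at its limit points.\<close>
  moreover have "at (0::real) within {0..} \<noteq> bot"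
    by (simp add: at_within_Ici_at_right)
  ultimately show False
    using vector_derivative_unique_within[of 0 "{0..}" "velocity x" 0 "- g x0"] assms(2) by simp
qed

theorem lemma3p1:
  fixes f :: "real ^ 'n \<Rightarrow> real"
    and grad_f :: "real ^ 'n \<Rightarrow> real ^ 'n"
    and x0 :: "real ^ 'n"
    and L :: real
    and x :: "real \<Rightarrow> real ^ 'n"
  assumes "coercive f"
    and "\<And>y. GDERIV f y :> grad_f y"
    and "continuous_on UNIV grad_f"
    and "L > 0"
    and "L-lipschitz_on UNIV grad_f"
    and "grad_f x0 \<noteq> 0"
    and "solves_from_rest grad_f x0 x"
  shows "\<exists>t>0. kinetic_energy x differentiable (at t) \<and>
           t * deriv (kinetic_energy x) t - kinetic_energy x t < 0"
proof -
  note sol = \<open>solves_from_rest grad_f x0 x\<close>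
  define E where "E = kinetic_energy x"
  define E' where "E' t = - (grad_f (x t) \<bullet> velocity x t)" for t
  \<comment> \<open>Positive times are interior to the half-line, so the derivative there is
    two-sided, as \<open>deriv\<close> in the goal requires.\<close>
  have dE: "(E has_real_derivative E' t) (at t)" if "t > 0" for t
  proof -
    have "at t within {0..} = at t"
      by (rule at_within_interior) (use that in simp)
    then show ?thesis
      using kinetic_energy_has_derivative[OF sol, of t] that by (simp add: E_def E'_def)
  qed
  have "continuous_on UNIV f"
    using assms(2) unfolding gderiv_def
    by (meson continuous_at_imp_continuous_on has_derivative_continuous)
  then obtain m where m: "\<And>y. m \<le> f y"
    using coercive_bounded_below assms(1) by blast
  have bound: "E t \<le> f x0 - m" if "t \<ge> 0" for t
    using energy_conservation[OF assms(2) sol that] m[of "x t"] by (simp add: E_def)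
  obtain s where s: "s > 0" "E s > 0"
    using obtain_positive_kinetic_energy[OF sol \<open>grad_f x0 \<noteq> 0\<close>] by (auto simp: E_def)
  have "\<exists>t>0. t * E' t - E t < 0"
  proof (rule ccontr)
    assume "\<not> ?thesis"
    then have ge: "E t \<le> t * E' t" if "t > 0" for t
      using that by force
    \<comment> \<open>By the quotient rule, the sign of the derivative of \<open>E t / t\<close> is
      that of \<open>t * E' t - E t\<close>.\<close>
    have lin: "E s / s \<le> E t / t" if "s \<le> t" for t
    proof (rule DERIV_nonneg_imp_nondecreasing[OF that])
      fix r assume "s \<le> r" "r \<le> t"
      with s have r: "r > 0" by simp
      have "((\<lambda>t. E t / t) has_real_derivative (E' r * r - E r * 1) / (r * r)) (at r)"
        by (rule DERIV_divide[OF dE[OF r] DERIV_ident]) (use r in simp)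
      moreover have "(E' r * r - E r * 1) / (r * r) \<ge> 0"
        using ge[OF r] by (simp add: mult.commute)
      ultimately show "\<exists>y. ((\<lambda>t. E t / t) has_real_derivative y) (at r) \<and> 0 \<le> y"
        by blast
    qed
    \<comment> \<open>The second argument of \<open>max\<close> makes the line of slope
      \<open>E s / s\<close> exceed the bound \<open>f x0 - m\<close> by at least 1; the first keeps
      \<open>t\<close> in the range where \<open>lin\<close> applies.\<close>
    define t where "t = max s ((f x0 - m + 1) / (E s / s))"
    have t: "s \<le> t" "(f x0 - m + 1) / (E s / s) \<le> t" by (auto simp: t_def)
    have "f x0 - m + 1 \<le> t * (E s / s)"
      using t(2) s by (simp add: pos_divide_le_eq del: divide_divide_eq_right)
    also have "\<dots> \<le> t * (E t / t)"
      using lin[OF t(1)] s t(1) by (intro mult_left_mono) auto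
    also have "\<dots> = E t" using s t(1) by simp
    finally show False using bound[of t] s t(1) by simp
  qed
  then obtain t where t: "t > 0" "t * E' t - E t < 0" by blast
  moreover have "E differentiable (at t)"
    using dE[OF t(1)] real_differentiable_def by blast
  ultimately show ?thesis
    using DERIV_imp_deriv[OF dE[OF t(1)]] by (auto simp: E_def)
qed

end
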